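(* For any integer $n\geqslant 2$, the semigroup (under composition) of all injective endomorphisms of the semigroup $\mathscr{I}_{\omega}^{n}(\overrightarrow{\mathrm{conv}})$ is isomorphic to the semigroup $(\omega,+)$. In particular, the group of automorphisms of $\mathscr{I}_{\omega}^{n}(\overrightarrow{\mathrm{conv}})$ is trivial.
   Context: $\omega$ is the set of all non-negative integers with its usual order $\leqslant$, and $(\omega,+)$ is $\omega$ with usual addition. A subset $X\subseteq\omega$ is order-convex if $x\leqslant z\leqslant y$ and $x,y\in X$ imply $z\in X$. For a positive integer $n$, $\mathscr{I}_{\omega}^{n}(\overrightarrow{\mathrm{conv}})$ is the semigroup of all partial order isomorphisms between order-convex subsets of $(\omega,\leqslant)$ whose domain has at most $n$ elements (including the empty map), under composition of partial maps written on the right: $x(\alpha\beta)=(x\alpha)\beta$ on $\operatorname{dom}(\alpha\beta)=\{y\in\operatorname{dom}\alpha\colon y\alpha\in\operatorname{dom}\beta\}$. The empty partial map is the zero $\boldsymbol{0}$; the non-zero elements are exactly the maps sending $i+t$ to $j+t$ for $0\leqslant t\leqslant k$, where $i,j\in\omega$ and $0\leqslant k\leqslant n-1$. An endomorphism of a semigroup is a homomorphism to itself; an automorphism is a bijective endomorphism. *)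

theory Defs
  imports "HOL-Algebra.Bij" "HOL-Algebra.Elementary_Groups"
begin

definition order_convex :: "nat set \<Rightarrow> bool" where
  "order_convex X \<longleftrightarrow> (\<forall>x\<in>X. \<forall>y\<in>X. \<forall>z. x \<le> z \<and> z \<le> y \<longrightarrow> z \<in> X)"

definition partial_order_iso :: "(nat \<rightharpoonup> nat) \<Rightarrow> bool" where
  "partial_order_iso \<alpha> \<longleftrightarrow>
     inj_on \<alpha> (dom \<alpha>) \<and>
     (\<forall>x\<in>dom \<alpha>. \<forall>y\<in>dom \<alpha>. x \<le> y \<longleftrightarrow> the (\<alpha> x) \<le> the (\<alpha> y))"

text \<open>
  Semigroups are presented as records of type \<^typ>\<open>'a monoid\<close>, because \<^const>\<open>hom\<close>, \<^const>\<open>mon\<close>,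
  \<^const>\<open>is_iso\<close> and \<^const>\<open>AutoGroup\<close> are stated for that type; they use only the carrier and the
  multiplication. The semigroup below has no identity element, so its \<open>one\<close> field is
  left unspecified. Partial maps act on the right, \<open>x(\<alpha>\<beta>) = (x\<alpha>)\<beta>\<close>, hence the swapped
  arguments of \<open>\<circ>\<^sub>m\<close>.
\<close>

definition conv_semigroup :: "nat \<Rightarrow> (nat \<rightharpoonup> nat) monoid" where
  "conv_semigroup n =
     \<lparr>carrier = {\<alpha>. partial_order_iso \<alpha> \<and> order_convex (dom \<alpha>) \<and> order_convex (ran \<alpha>) \<and>
                    finite (dom \<alpha>) \<and> card (dom \<alpha>) \<le> n},
      mult = (\<lambda>\<alpha> \<beta>. \<beta> \<circ>\<^sub>m \<alpha>),
      one = undefined\<rparr>"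

text \<open>
  Endomorphisms are taken to be extensional, as in \<^const>\<open>Bij\<close> and \<^const>\<open>AutoGroup\<close>, so that each map
  on the carrier is represented exactly once. They are composed as maps written on the right.
\<close>

definition inj_End :: "('a, 'b) monoid_scheme \<Rightarrow> ('a \<Rightarrow> 'a) monoid" where
  "inj_End S =
     \<lparr>carrier = mon S S \<inter> extensional (carrier S),
      mult = (\<lambda>\<sigma> \<tau>. compose (carrier S) \<tau> \<sigma>),
      one = (\<lambda>x\<in>carrier S. x)\<rparr>"

definition omega_add :: "nat monoid" where
  "omega_add = \<lparr>carrier = UNIV, mult = (+), one = 0\<rparr>"

lemma partial_order_iso_le_iff:
  assumes "partial_order_iso \<alpha>" "\<alpha> x = Some u" "\<alpha> y = Some v"
  shows "x \<le> y \<longleftrightarrow> u \<le> v"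
proof -
  have "x \<in> dom \<alpha>" "y \<in> dom \<alpha>" using assms(2,3) by blast+
  then have "x \<le> y \<longleftrightarrow> the (\<alpha> x) \<le> the (\<alpha> y)"
    using assms(1) unfolding partial_order_iso_def by blast
  then show ?thesis using assms(2,3) by simp
qed

lemma conv_semigroup_closed:
  assumes "\<alpha> \<in> carrier (conv_semigroup n)" "\<beta> \<in> carrier (conv_semigroup n)"
  shows "\<alpha> \<otimes>\<^bsub>conv_semigroup n\<^esub> \<beta> \<in> carrier (conv_semigroup n)"
proof -
  let ?c = "\<beta> \<circ>\<^sub>m \<alpha>"
  have iso\<alpha>: "partial_order_iso \<alpha>" and iso\<beta>: "partial_order_iso \<beta>"
    and dom\<alpha>: "order_convex (dom \<alpha>)" "finite (dom \<alpha>)" "card (dom \<alpha>) \<le> n"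
    and dom\<beta>: "order_convex (dom \<beta>)" and ran\<alpha>: "order_convex (ran \<alpha>)" and ran\<beta>: "order_convex (ran \<beta>)"
    using assms by (simp_all add: conv_semigroup_def)
  note ord\<alpha> = partial_order_iso_le_iff[OF iso\<alpha>] and ord\<beta> = partial_order_iso_le_iff[OF iso\<beta>]
  have sub: "dom ?c \<subseteq> dom \<alpha>"
    by (auto simp: map_comp_Some_iff)
  have cE: "\<exists>p. \<alpha> x = Some p \<and> \<beta> p = Some u" if "?c x = Some u" for x u
    using that by (auto simp: map_comp_Some_iff)
  have ord: "x \<le> y \<longleftrightarrow> u \<le> v" if uv: "?c x = Some u" "?c y = Some v" for x y u v
  proof -
    obtain p q where pq: "\<alpha> x = Some p" "\<beta> p = Some u" "\<alpha> y = Some q" "\<beta> q = Some v"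
      using cE[OF uv(1)] cE[OF uv(2)] by blast
    show ?thesis using ord\<alpha>[OF pq(1,3)] ord\<beta>[OF pq(2,4)] by simp
  qed
  have "partial_order_iso ?c"
    unfolding partial_order_iso_def inj_on_def
  proof (intro conjI ballI impI)
    fix x y assume "x \<in> dom ?c" "y \<in> dom ?c" "?c x = ?c y"
    then obtain u where u: "?c x = Some u" "?c y = Some u" by (metis domD)
    show "x = y" using ord[OF u] ord[OF u(2,1)] by simp
  next
    fix x y assume "x \<in> dom ?c" "y \<in> dom ?c"
    then obtain u v where uv: "?c x = Some u" "?c y = Some v" by (metis domD)
    show "x \<le> y \<longleftrightarrow> the (?c x) \<le> the (?c y)" using ord[OF uv] uv by simp
  qed
  moreover have "order_convex (dom ?c)"
    unfolding order_convex_def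
  proof (intro ballI allI impI)
    fix x y z assume "x \<in> dom ?c" "y \<in> dom ?c" and z: "x \<le> z \<and> z \<le> y"
    then obtain p q u v where pq: "\<alpha> x = Some p" "\<beta> p = Some u" "\<alpha> y = Some q" "\<beta> q = Some v"
      using cE unfolding dom_def by blast
    have "p \<in> dom \<beta>" "q \<in> dom \<beta>" "x \<in> dom \<alpha>" "y \<in> dom \<alpha>" using pq by blast+
    note doms = this
    then have "z \<in> dom \<alpha>" using dom\<alpha>(1) z unfolding order_convex_def by blast
    then obtain r where r: "\<alpha> z = Some r" by blast
    have "p \<le> r \<and> r \<le> q" using ord\<alpha>[OF pq(1) r] ord\<alpha>[OF r pq(3)] z by simp
    then have "r \<in> dom \<beta>" using dom\<beta> doms unfolding order_convex_def by blast
    then show "z \<in> dom ?c" using r by (auto simp: map_comp_def)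
  qed
  moreover have "order_convex (ran ?c)"
    unfolding order_convex_def
  proof (intro ballI allI impI)
    fix u v w assume "u \<in> ran ?c" "v \<in> ran ?c" and w: "u \<le> w \<and> w \<le> v"
    then obtain x y p q where pq: "\<alpha> x = Some p" "\<beta> p = Some u" "\<alpha> y = Some q" "\<beta> q = Some v"
      using cE unfolding ran_def by blast
    have "w \<in> ran \<beta>"
      using ran\<beta> w ranI[where m=\<beta>, OF pq(2)] ranI[where m=\<beta>, OF pq(4)] unfolding order_convex_def by blast
    then obtain r where r: "\<beta> r = Some w" by (auto simp: ran_def)
    have "p \<le> r \<and> r \<le> q" using ord\<beta>[OF pq(2) r] ord\<beta>[OF r pq(4)] w by simp
    then have "r \<in> ran \<alpha>" 
      using ran\<alpha> ranI[where m=\<alpha>, OF pq(1)] ranI[where m=\<alpha>, OF pq(3)] unfolding order_convex_def by blast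
    then obtain z where "\<alpha> z = Some r" by (auto simp: ran_def)
    then have "?c z = Some w" using r by simp
    then show "w \<in> ran ?c" by (rule ranI)
  qed
  moreover have "finite (dom ?c)" "card (dom ?c) \<le> n"
    using finite_subset[OF sub dom\<alpha>(2)] card_mono[OF dom\<alpha>(2) sub] dom\<alpha>(3) by simp_all
  ultimately show ?thesis by (simp add: conv_semigroup_def)
qed

lemma conv_semigroup_assoc:
  "(\<alpha> \<otimes>\<^bsub>conv_semigroup n\<^esub> \<beta>) \<otimes>\<^bsub>conv_semigroup n\<^esub> \<gamma> =
   \<alpha> \<otimes>\<^bsub>conv_semigroup n\<^esub> (\<beta> \<otimes>\<^bsub>conv_semigroup n\<^esub> \<gamma>)"
  by (auto simp: conv_semigroup_def map_comp_def fun_eq_iff split: option.split)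

lemma conv_semigroup_carrier:
  "carrier (conv_semigroup n) =
     insert Map.empty
       {\<alpha>. \<exists>i j k. k < n \<and> \<alpha> = (\<lambda>x. if x \<in> {i..i+k} then Some (j + (x - i)) else None)}"
proof (intro equalityI subsetI)
  fix \<alpha> assume "\<alpha> \<in> carrier (conv_semigroup n)"
  then have iso: "partial_order_iso \<alpha>"
    and dom\<alpha>: "order_convex (dom \<alpha>)" "finite (dom \<alpha>)" "card (dom \<alpha>) \<le> n"
    and ran\<alpha>: "order_convex (ran \<alpha>)"
    by (simp_all add: conv_semigroup_def)
  note ord = partial_order_iso_le_iff[OF iso]
  show "\<alpha> \<in> insert Map.empty
     {\<alpha>. \<exists>i j k. k < n \<and> \<alpha> = (\<lambda>x. if x \<in> {i..i+k} then Some (j + (x - i)) else None)}"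
  proof (cases "dom \<alpha> = {}")
    case True
    then show ?thesis by simp
  next
    case False
    define i where "i = Min (dom \<alpha>)"
    define k where "k = Max (dom \<alpha>) - i"
    have ends: "i \<in> dom \<alpha>" "i + k \<in> dom \<alpha>"
      using False Min_in[OF dom\<alpha>(2)] Max_in[OF dom\<alpha>(2)] Min_le[OF dom\<alpha>(2), of "Max (dom \<alpha>)"]
      by (simp_all add: i_def k_def)
    have dom_eq: "dom \<alpha> = {i..i+k}"
    proof
      show "dom \<alpha> \<subseteq> {i..i+k}"
      proof
        fix x assume "x \<in> dom \<alpha>"
        then show "x \<in> {i..i+k}"
          using Min_le[OF dom\<alpha>(2), of x] Max_ge[OF dom\<alpha>(2), of x] by (simp add: i_def k_def)
      qed
      show "{i..i+k} \<subseteq> dom \<alpha>"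
        
      proof
        fix x assume "x \<in> {i..i+k}"
        then show "x \<in> dom \<alpha>"
          using ends dom\<alpha>(1) unfolding order_convex_def atLeastAtMost_iff by blast
      qed
    qed
    obtain j where j: "\<alpha> i = Some j" using ends(1) by blast
    have step: "\<alpha> (i + t) = Some (j + t)" if "t \<le> k" for t
      using that
    proof (induction t)
      case 0
      show ?case using j by simp
    next
      case (Suc t)
      then have IH: "\<alpha> (i + t) = Some (j + t)" by simp
      have "i + Suc t \<in> dom \<alpha>" using Suc.prems dom_eq by simp
      then obtain v where v: "\<alpha> (i + Suc t) = Some v" by blast
      have gt: "j + t < v" using ord[OF v IH] by simp
      then have "j + t \<le> j + Suc t \<and> j + Suc t \<le> v" by simp
      then have "j + Suc t \<in> ran \<alpha>"
        using ran\<alpha> ranI[where m=\<alpha>, OF v] ranI[where m=\<alpha>, OF IH] unfolding order_convex_def by blast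
      then obtain y where y: "\<alpha> y = Some (j + Suc t)" by (auto simp: ran_def)
      have "\<not> y \<le> i + t" using ord[OF y IH] by simp
      moreover have "y \<le> i + Suc t" using ord[OF y v] gt by simp
      ultimately have "y = i + Suc t" by simp
      then show ?case using y by simp
    qed
    have "\<alpha> = (\<lambda>x. if x \<in> {i..i+k} then Some (j + (x - i)) else None)"
    proof
      fix x
      show "\<alpha> x = (if x \<in> {i..i+k} then Some (j + (x - i)) else None)"
      proof (cases "x \<in> {i..i+k}")
        case True
        then show ?thesis using step[of "x - i"] by auto
      next
        case False
        then show ?thesis using dom_eq by (metis domIff)
      qed
    qed
    moreover have "k < n" using dom\<alpha>(3) dom_eq by simp
    ultimately show ?thesis by blast
  qed
next
  fix \<alpha> assume "\<alpha> \<in> insert Map.empty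
     {\<alpha>. \<exists>i j k. k < n \<and> \<alpha> = (\<lambda>x. if x \<in> {i..i+k} then Some (j + (x - i)) else None)}"
  then show "\<alpha> \<in> carrier (conv_semigroup n)"
  proof (elim insertE CollectE exE conjE)
    assume "\<alpha> = Map.empty"
    then show ?thesis
      by (simp add: conv_semigroup_def partial_order_iso_def order_convex_def)
  next
    fix i j k assume k: "k < n"
      and \<alpha>: "\<alpha> = (\<lambda>x. if x \<in> {i..i+k} then Some (j + (x - i)) else None)"
    have dom_eq: "dom \<alpha> = {i..i+k}"
      by (auto simp: \<alpha> dom_def)
    have ran_eq: "ran \<alpha> = {j..j+k}"
    proof
      show "ran \<alpha> \<subseteq> {j..j+k}"
        by (auto simp: \<alpha> ran_def split: if_splits)
      show "{j..j+k} \<subseteq> ran \<alpha>"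
      proof
        fix y assume "y \<in> {j..j+k}"
        then have "\<alpha> (i + (y - j)) = Some y" by (auto simp: \<alpha>)
        then show "y \<in> ran \<alpha>" by (rule ranI)
      qed
    qed
    have "partial_order_iso \<alpha>"
      unfolding partial_order_iso_def inj_on_def dom_eq by (auto simp: \<alpha>)
    then show ?thesis
      using k by (simp add: conv_semigroup_def dom_eq ran_eq order_convex_def)
  qed
qed

lemma inj_End_closed:
  assumes mult: "\<And>x y. x \<in> carrier S \<Longrightarrow> y \<in> carrier S \<Longrightarrow> x \<otimes>\<^bsub>S\<^esub> y \<in> carrier S"
    and "\<sigma> \<in> carrier (inj_End S)" "\<tau> \<in> carrier (inj_End S)"
  shows "\<sigma> \<otimes>\<^bsub>inj_End S\<^esub> \<tau> \<in> carrier (inj_End S)"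
proof -
  have \<sigma>: "\<sigma> \<in> hom S S" "inj_on \<sigma> (carrier S)" and \<tau>: "\<tau> \<in> hom S S" "inj_on \<tau> (carrier S)"
    using assms(2,3) by (simp_all add: inj_End_def mon_def)
  have "compose (carrier S) \<tau> \<sigma> \<in> hom S S"
    using \<sigma>(1) \<tau>(1) by (simp add: hom_def compose_def Pi_iff mult)
  moreover have "inj_on (compose (carrier S) \<tau> \<sigma>) (carrier S)"
  proof (rule inj_onI)
    fix x y assume xy: "x \<in> carrier S" "y \<in> carrier S"
      and "compose (carrier S) \<tau> \<sigma> x = compose (carrier S) \<tau> \<sigma> y"
    then have "\<tau> (\<sigma> x) = \<tau> (\<sigma> y)" by (simp add: compose_def)
    then have "\<sigma> x = \<sigma> y"
      using xy hom_in_carrier[OF \<sigma>(1)] inj_onD[OF \<tau>(2)] by blast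
    then show "x = y" using xy inj_onD[OF \<sigma>(2)] by blast
  qed
  ultimately show ?thesis
    by (simp add: inj_End_def mon_def compose_extensional)
qed

end

theory Submission
  imports Defs
begin

text \<open>
  An injective endomorphism \<open>\<sigma>\<close> strictly preserves the natural order of idempotents. The partial
  identities of intervals with \<open>0, \<dots>, n\<close> elements form a chain of the maximal length \<open>n + 1\<close>, so
  \<open>\<sigma>\<close> preserves the size of an interval. On one-point intervals \<open>\<sigma>\<close> is thus given by an injection \<open>f\<close>
  of \<open>\<omega>\<close>, and two-point intervals (here \<open>n \<ge> 2\<close> enters) force \<open>f i\<close> and \<open>f (i + 1)\<close> to be
  adjacent. An injective sequence of naturals with unit steps is \<open>i \<mapsto> p + i\<close>. Each element is
  determined by its products with the one-point idempotents, so \<open>\<sigma>\<close> is conjugation by the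
  translation \<open>x \<mapsto> p + x\<close>. Only \<open>p = 0\<close> gives a surjective map.
\<close>

section \<open>Interval shifts, idempotents and their natural order\<close>

text \<open>Here \<open>k\<close> counts the points of the interval, so \<open>k = 0\<close> yields
  the zero of the semigroup and one family with \<open>k \<le> n\<close> covers all
  elements.\<close>

definition shift_map :: "nat \<Rightarrow> nat \<Rightarrow> nat \<Rightarrow> nat \<rightharpoonup> nat" where
  "shift_map i j k = (\<lambda>x. if x \<in> {i..<i+k} then Some (j + (x - i)) else None)"

lemma shift_map_0 [simp]: "shift_map i j 0 = Map.empty"
  by (simp add: shift_map_def)

lemma shift_map_1: "shift_map i j 1 = [i \<mapsto> j]"
  by (auto simp: shift_map_def)

lemma dom_shift_map [simp]: "dom (shift_map i j k) = {i..<i+k}"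
  by (auto simp: shift_map_def dom_def)

lemma carrier_conv_semigroup_shift_map:
  "carrier (conv_semigroup n) = {shift_map i j k | i j k. k \<le> n}"
proof -
  have "shift_map i j (Suc k) = (\<lambda>x. if x \<in> {i..i+k} then Some (j + (x - i)) else None)" for i j k
    by (auto simp: shift_map_def)
  then have "carrier (conv_semigroup n) = insert Map.empty {shift_map i j (Suc k) | i j k. k < n}"
    unfolding conv_semigroup_carrier by auto
  also have "\<dots> = {shift_map i j k | i j k. k \<le> n}"
  proof (intro equalityI subsetI)
    fix \<alpha> assume "\<alpha> \<in> {shift_map i j k | i j k. k \<le> n}"
    then obtain i j k where "\<alpha> = shift_map i j k" "k \<le> n" by blast
    then show "\<alpha> \<in> insert Map.empty {shift_map i j (Suc k) | i j k. k < n}"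
      by (cases k) (auto simp: Suc_le_eq)
  next
    fix \<alpha> assume "\<alpha> \<in> insert Map.empty {shift_map i j (Suc k) | i j k. k < n}"
    then consider "\<alpha> = shift_map 0 0 0" | i j k where "\<alpha> = shift_map i j (Suc k)" "Suc k \<le> n"
      by auto
    then show "\<alpha> \<in> {shift_map i j k | i j k. k \<le> n}"
      by cases blast+
  qed
  finally show ?thesis .
qed

lemma shift_map_in_carrier: "k \<le> n \<Longrightarrow> shift_map i j k \<in> carrier (conv_semigroup n)"
  unfolding carrier_conv_semigroup_shift_map by blast

lemma mult_conv_semigroup [simp]: "\<alpha> \<otimes>\<^bsub>conv_semigroup n\<^esub> \<beta> = \<beta> \<circ>\<^sub>m \<alpha>"
  by (simp add: conv_semigroup_def)

text \<open>Idempotency makes \<open>y\<close> a fixed point, so \<open>x\<close> and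
  \<open>y\<close> have the same image and injectivity identifies them. Idempotents are thus partial
  identities.\<close>

lemma idempotent_conv_semigroup:
  assumes "\<alpha> \<in> carrier (conv_semigroup n)" "\<alpha> \<circ>\<^sub>m \<alpha> = \<alpha>" "\<alpha> x = Some y"
  shows "y = x"
proof -
  have "\<alpha> y = Some y"
    using assms(2,3) by (metis map_comp_simps(2))
  moreover have "inj_on \<alpha> (dom \<alpha>)"
    using assms(1) by (simp add: conv_semigroup_def partial_order_iso_def)
  ultimately show ?thesis
    using assms(3) by (metis domI inj_onD)
qed

text \<open>The premise \<open>\<beta> \<circ>\<^sub>m \<alpha> = \<alpha>\<close> is the natural
  order of idempotents. Partial identities are determined by their domains, so this order is
  inclusion of domains.\<close>

lemma card_dom_idempotent_less:
  assumes S: "\<alpha> \<in> carrier (conv_semigroup n)" "\<beta> \<in> carrier (conv_semigroup n)"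
    and idem: "\<alpha> \<circ>\<^sub>m \<alpha> = \<alpha>" "\<beta> \<circ>\<^sub>m \<beta> = \<beta>" and le: "\<beta> \<circ>\<^sub>m \<alpha> = \<alpha>" and ne: "\<alpha> \<noteq> \<beta>"
  shows "card (dom \<alpha>) < card (dom \<beta>)"
proof -
  have a: "\<alpha> x = Some x" if "x \<in> dom \<alpha>" for x
    using that idempotent_conv_semigroup[OF S(1) idem(1)] by fastforce
  have b: "\<beta> x = Some x" if "x \<in> dom \<beta>" for x
    using that idempotent_conv_semigroup[OF S(2) idem(2)] by fastforce
  have "dom \<alpha> \<subseteq> dom \<beta>"
    using le a by (metis domI map_comp_simps(2) subsetI)
  moreover have "dom \<alpha> \<noteq> dom \<beta>"
    using a b ne by (metis domIff ext)
  moreover have "finite (dom \<beta>)"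
    using S(2) by (simp add: conv_semigroup_def)
  ultimately show ?thesis
    by (simp add: psubset_card_mono psubset_eq)
qed

text \<open>Two consecutive steps in opposite directions would return to the same value, against
  injectivity. Hence the direction never changes, and an endless descent is impossible in the
  naturals.\<close>

lemma injective_unit_steps:
  fixes f :: "nat \<Rightarrow> nat"
  assumes inj: "inj f" and step: "\<And>i. f (Suc i) = Suc (f i) \<or> f i = Suc (f (Suc i))"
  shows "f i = f 0 + i"
proof -
  have same: "f (Suc (Suc i)) = Suc (f (Suc i)) \<longleftrightarrow> f (Suc i) = Suc (f i)" for i
  proof -
    have "f (Suc (Suc i)) \<noteq> f i"
      using injD[OF inj, of "Suc (Suc i)" i] by fastforce
    then show ?thesis
      using step[of i] step[of "Suc i"] by linarith
  qed
  have const: "f (Suc i) = Suc (f i) \<longleftrightarrow> f 1 = Suc (f 0)" for i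
    by (induction i) (simp_all only: same One_nat_def)
  have "f 1 = Suc (f 0)"
  proof (rule ccontr)
    assume "f 1 \<noteq> Suc (f 0)"
    then have down: "f i = Suc (f (Suc i))" for i
      using step const by blast
    have "f 0 = f i + i" for i
    proof (induction i)
      case (Suc i)
      then show ?case using down[of i] by simp
    qed simp
    from this[of "Suc (f 0)"] show False by simp
  qed
  then have "f (Suc i) = Suc (f i)" for i
    using const by blast
  then show ?thesis
    by (induction i) simp_all
qed

section \<open>Endomorphisms induced by translations\<close>

text \<open>The guard \<open>p \<le> x\<close> keeps points outside the range of the translation
  undefined, where truncated subtraction would wrongly give 0.\<close>

definition shift_endo :: "nat \<Rightarrow> nat \<Rightarrow> (nat \<rightharpoonup> nat) \<Rightarrow> nat \<rightharpoonup> nat" where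
  "shift_endo n p =
     (\<lambda>\<alpha>\<in>carrier (conv_semigroup n). \<lambda>x. if p \<le> x then map_option ((+) p) (\<alpha> (x - p)) else None)"

lemma shift_endo_shift_map:
  assumes "k \<le> n"
  shows "shift_endo n p (shift_map i j k) = shift_map (p + i) (p + j) k"
  using shift_map_in_carrier[OF assms] assms
  by (auto simp: shift_endo_def shift_map_def fun_eq_iff)

lemma shift_endo_in_inj_End: "shift_endo n p \<in> carrier (inj_End (conv_semigroup n))"
proof -
  let ?S = "conv_semigroup n"
  have closed: "shift_endo n p \<alpha> \<in> carrier ?S" if "\<alpha> \<in> carrier ?S" for \<alpha>
  proof -
    obtain i j k where "\<alpha> = shift_map i j k" "k \<le> n"
      using \<open>\<alpha> \<in> carrier ?S\<close> unfolding carrier_conv_semigroup_shift_map by blast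
    then show ?thesis by (simp add: shift_endo_shift_map shift_map_in_carrier)
  qed
  \<comment> \<open>Values of the first factor have the form \<open>p + y\<close>, so the guard of
    the second factor holds and its subtraction of \<open>p\<close> cancels.\<close>
  moreover have "shift_endo n p (\<beta> \<circ>\<^sub>m \<alpha>) = shift_endo n p \<beta> \<circ>\<^sub>m shift_endo n p \<alpha>"
    if "\<alpha> \<in> carrier ?S" "\<beta> \<in> carrier ?S" for \<alpha> \<beta>
    using that conv_semigroup_closed[OF that]
    by (auto simp: shift_endo_def fun_eq_iff map_comp_def split: option.split)
  ultimately have "shift_endo n p \<in> hom ?S ?S"
    by (auto simp: hom_def)
  moreover have "inj_on (shift_endo n p) (carrier ?S)"
  proof (rule inj_onI)
    fix \<alpha> \<beta> assume S: "\<alpha> \<in> carrier ?S" "\<beta> \<in> carrier ?S"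
      and eq: "shift_endo n p \<alpha> = shift_endo n p \<beta>"
    have "map_option ((+) p) (\<alpha> x) = map_option ((+) p) (\<beta> x)" for x
      using fun_cong[OF eq, of "p + x"] S by (simp add: shift_endo_def)
    moreover have "inj ((+) p)" by simp
    ultimately show "\<alpha> = \<beta>"
      by (meson ext injD option.inj_map)
  qed
  ultimately show ?thesis
    by (simp add: inj_End_def mon_def shift_endo_def)
qed

lemma shift_endo_mult:
  "shift_endo n p \<otimes>\<^bsub>inj_End (conv_semigroup n)\<^esub> shift_endo n q = shift_endo n (p + q)"
proof
  fix \<alpha>
  show "(shift_endo n p \<otimes>\<^bsub>inj_End (conv_semigroup n)\<^esub> shift_endo n q) \<alpha> = shift_endo n (p + q) \<alpha>"
  proof (cases "\<alpha> \<in> carrier (conv_semigroup n)")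
    case True
    then obtain i j k where "\<alpha> = shift_map i j k" "k \<le> n"
      unfolding carrier_conv_semigroup_shift_map by blast
    then show ?thesis
      using True by (simp add: inj_End_def compose_def shift_endo_shift_map add_ac)
  next
    case False
    then show ?thesis by (simp add: inj_End_def compose_def shift_endo_def)
  qed
qed

text \<open>The idempotent at the point 0 is moved to the point \<open>p\<close>, which recovers
  \<open>p\<close>. For \<open>n = 0\<close> there is no such element and all these maps
  coincide.\<close>

lemma shift_endo_inj:
  assumes "n \<ge> 1" "shift_endo n p = shift_endo n q"
  shows "p = q"
proof -
  have "shift_endo n p (shift_map 0 0 1) = shift_endo n q (shift_map 0 0 1)"
    using assms(2) by simp
  then have "dom (shift_map p p 1) = dom (shift_map q q 1)"
    using assms(1) by (simp add: shift_endo_shift_map)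
  then show ?thesis by simp
qed

section \<open>Structure of an arbitrary injective endomorphism\<close>

locale injective_endomorphism =
  fixes n :: nat and \<sigma> :: "(nat \<rightharpoonup> nat) \<Rightarrow> nat \<rightharpoonup> nat"
  assumes mon: "\<sigma> \<in> mon (conv_semigroup n) (conv_semigroup n)"
begin

lemma closed: "\<alpha> \<in> carrier (conv_semigroup n) \<Longrightarrow> \<sigma> \<alpha> \<in> carrier (conv_semigroup n)"
  using mon by (auto simp: mon_def hom_def)

lemma map_comp:
  "\<alpha> \<in> carrier (conv_semigroup n) \<Longrightarrow> \<beta> \<in> carrier (conv_semigroup n)
    \<Longrightarrow> \<sigma> (\<beta> \<circ>\<^sub>m \<alpha>) = \<sigma> \<beta> \<circ>\<^sub>m \<sigma> \<alpha>"
  using mon by (auto simp: mon_def hom_def)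

lemma map_comp_shift_map:
  "k \<le> n \<Longrightarrow> l \<le> n
    \<Longrightarrow> \<sigma> (shift_map a b l) \<circ>\<^sub>m \<sigma> (shift_map i j k) = \<sigma> (shift_map a b l \<circ>\<^sub>m shift_map i j k)"
  by (simp add: map_comp shift_map_in_carrier)

lemma inj: "inj_on \<sigma> (carrier (conv_semigroup n))"
  using mon by (simp add: mon_def)

lemma eq_iff:
  "\<alpha> \<in> carrier (conv_semigroup n) \<Longrightarrow> \<beta> \<in> carrier (conv_semigroup n) \<Longrightarrow> \<sigma> \<alpha> = \<sigma> \<beta> \<longleftrightarrow> \<alpha> = \<beta>"
  using inj by (rule inj_on_eq_iff)

text \<open>The hypotheses place \<open>{a..<a+k}\<close> inside \<open>{i..<i+l}\<close>, and a
  homomorphism preserves the natural order. The case \<open>a = i\<close>, \<open>k = l\<close> says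
  that the image of an interval idempotent is idempotent.\<close>

lemma interval_le:
  assumes "k \<le> l" "l \<le> n" "i \<le> a" "a + k \<le> i + l"
  shows "\<sigma> (shift_map i i l) \<circ>\<^sub>m \<sigma> (shift_map a a k) = \<sigma> (shift_map a a k)"
proof -
  have "shift_map i i l \<circ>\<^sub>m shift_map a a k = shift_map a a k"
    using assms by (auto simp: shift_map_def fun_eq_iff map_comp_def)
  then show ?thesis
    using assms by (simp add: map_comp_shift_map)
qed

text \<open>Strict growth of \<open>c\<close> leaves no room: counting up from 0 gives
  \<open>k \<le> c k\<close>, and counting on to \<open>n\<close> gives
  \<open>c k + (n - k) \<le> c n \<le> n\<close>.\<close>

lemma card_dom_interval:
  assumes "k \<le> n"
  shows "card (dom (\<sigma> (shift_map i i k))) = k"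
proof -
  define c where "c k = card (dom (\<sigma> (shift_map i i k)))" for k
  have less: "c k < c (Suc k)" if "Suc k \<le> n" for k
    unfolding c_def
  proof (rule card_dom_idempotent_less)
    have "card (dom (shift_map i i k)) \<noteq> card (dom (shift_map i i (Suc k)))" by simp
    then have "shift_map i i k \<noteq> shift_map i i (Suc k)" by metis
    then show "\<sigma> (shift_map i i k) \<noteq> \<sigma> (shift_map i i (Suc k))"
      using that by (subst eq_iff) (auto intro: shift_map_in_carrier)
  qed (use that in \<open>auto intro!: closed shift_map_in_carrier interval_le\<close>)
  have "k \<le> c k" if "k \<le> n" for k
    using that
  proof (induction k)
    case (Suc k)
    then show ?case using less[of k] by simp
  qed simp
  then have "k \<le> c k" using assms .
  moreover have "c k + d \<le> c (k + d)" if "k + d \<le> n" for d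
    using that
  proof (induction d)
    case (Suc d)
    then show ?case using less[of "k + d"] by simp
  qed simp
  then have "c k + (n - k) \<le> c n" using assms by (metis le_add_diff_inverse order_refl)
  moreover have "c n \<le> n"
    using closed[OF shift_map_in_carrier[OF order_refl], of i i] by (simp add: c_def conv_semigroup_def)
  ultimately show ?thesis
    using assms by (simp add: c_def)
qed

text \<open>A homomorphism need not fix the zero in general; here the size count forces it.\<close>

lemma empty: "\<sigma> Map.empty = Map.empty"
proof -
  have S: "Map.empty \<in> carrier (conv_semigroup n)"
    using shift_map_in_carrier[of 0 n 0 0] by simp
  then have "finite (dom (\<sigma> Map.empty))"
    using closed by (simp add: conv_semigroup_def)
  then show ?thesis
    using card_dom_interval[of 0 0] by simp
qed

text \<open>For \<open>n \<ge> 1\<close> the domain is a singleton by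
  \<open>card_dom_interval\<close>, so \<open>the_elem\<close> is meaningful.\<close>

definition f :: "nat \<Rightarrow> nat" where
  "f i = the_elem (dom (\<sigma> (shift_map i i 1)))"

lemma point_idempotent:
  assumes "n \<ge> 1"
  shows "\<sigma> (shift_map i i 1) = [f i \<mapsto> f i]"
proof -
  have S: "\<sigma> (shift_map i i 1) \<in> carrier (conv_semigroup n)"
    using assms by (intro closed shift_map_in_carrier)
  have idem: "\<sigma> (shift_map i i 1) \<circ>\<^sub>m \<sigma> (shift_map i i 1) = \<sigma> (shift_map i i 1)"
    using assms by (intro interval_le) auto
  have "card (dom (\<sigma> (shift_map i i 1))) = 1"
    using assms by (rule card_dom_interval)
  then obtain a where "dom (\<sigma> (shift_map i i 1)) = {a}"
    by (auto simp: card_1_singleton_iff)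
  then have dom: "dom (\<sigma> (shift_map i i 1)) = {f i}"
    by (simp add: f_def)
  then obtain y where y: "\<sigma> (shift_map i i 1) = [f i \<mapsto> y]"
    by (metis dom_eq_singleton_conv)
  moreover have "y = f i"
    by (rule idempotent_conv_semigroup[OF S idem]) (simp only: y fun_upd_same)
  ultimately show ?thesis by simp
qed

text \<open>Absorbing the idempotent at \<open>i\<close> as first factor confines the domain to
  \<open>f i\<close>; absorbing the one at \<open>j\<close> as last factor confines the range to
  \<open>f j\<close>. The image is not empty, since the zero is already the image of the
  zero.\<close>

lemma point:
  assumes "n \<ge> 1"
  shows "\<sigma> (shift_map i j 1) = [f i \<mapsto> f j]"
proof -
  let ?\<alpha> = "\<sigma> (shift_map i j 1)"
  have left: "?\<alpha> \<circ>\<^sub>m [f i \<mapsto> f i] = ?\<alpha>" and right: "[f j \<mapsto> f j] \<circ>\<^sub>m ?\<alpha> = ?\<alpha>"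
  proof -
    have "shift_map i j 1 \<circ>\<^sub>m shift_map i i 1 = shift_map i j 1"
      "shift_map j j 1 \<circ>\<^sub>m shift_map i j 1 = shift_map i j 1"
      by (auto simp: shift_map_1 map_comp_def fun_eq_iff simp del: One_nat_def)
    then show "?\<alpha> \<circ>\<^sub>m [f i \<mapsto> f i] = ?\<alpha>" "[f j \<mapsto> f j] \<circ>\<^sub>m ?\<alpha> = ?\<alpha>"
      unfolding point_idempotent[OF assms, symmetric]
      using assms by (simp_all add: map_comp_shift_map del: One_nat_def)
  qed
  have "?\<alpha> \<noteq> Map.empty"
  proof -
    have "shift_map i j 1 \<noteq> shift_map 0 0 0"
      by (simp add: shift_map_1 del: One_nat_def)
    then have "?\<alpha> \<noteq> \<sigma> (shift_map 0 0 0)"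
      using assms eq_iff[OF shift_map_in_carrier shift_map_in_carrier, of 1 0 i j 0 0] by blast
    then show ?thesis by (simp add: empty)
  qed
  then obtain x y where xy: "?\<alpha> x = Some y"
    by (metis not_None_eq)
  have dom: "u = f i \<and> v = f j" if "?\<alpha> u = Some v" for u v
  proof
    show "u = f i"
    proof (rule ccontr)
      assume "u \<noteq> f i"
      then have "(?\<alpha> \<circ>\<^sub>m [f i \<mapsto> f i]) u = None" by simp
      then show False using that left by simp
    qed
    have "([f j \<mapsto> f j] \<circ>\<^sub>m ?\<alpha>) u = [f j \<mapsto> f j] v"
      using that by (rule map_comp_simps(2))
    then have "[f j \<mapsto> f j] v = Some v"
      unfolding right that by (rule sym)
    then show "v = f j" by (simp split: if_splits)
  qed
  show ?thesis
  proof
    fix u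
    show "?\<alpha> u = [f i \<mapsto> f j] u"
    proof (cases "u = f i")
      case True
      then show ?thesis using dom[OF xy] xy by simp
    next
      case False
      then have "?\<alpha> u = None" using dom[of u] by (meson not_None_eq)
      then show ?thesis using False by simp
    qed
  qed
qed

lemma f_eq:
  assumes "n \<ge> 2"
  shows "f i = f 0 + i"
proof (rule injective_unit_steps)
  have n: "n \<ge> 1" using assms by simp
  show inj_f: "inj f"
  proof (rule injI)
    fix i j assume "f i = f j"
    then have "\<sigma> (shift_map i i 1) = \<sigma> (shift_map j j 1)"
      by (simp add: point_idempotent[OF n] del: One_nat_def)
    then have "shift_map i i 1 = shift_map j j 1"
      using n by (subst (asm) eq_iff) (auto intro: shift_map_in_carrier)
    then have "dom (shift_map i i 1) = dom (shift_map j j 1)" by simp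
    then show "i = j" by simp
  qed
  fix i
  \<comment> \<open>The image of the two-point idempotent has a block of two consecutive numbers as
    its domain. This block contains the distinct numbers \<open>f i\<close> and
    \<open>f (Suc i)\<close>, which are therefore adjacent.\<close>
  obtain a b k where abk: "\<sigma> (shift_map i i 2) = shift_map a b k" "k \<le> n"
    using closed[OF shift_map_in_carrier[OF assms], of i i]
    unfolding carrier_conv_semigroup_shift_map by blast
  then have k: "k = 2"
    using card_dom_interval[OF assms, of i] by simp
  have "f j \<in> {a..<a+2}" if "j \<in> {i, Suc i}" for j
  proof -
    have "shift_map a b 2 \<circ>\<^sub>m [f j \<mapsto> f j] = [f j \<mapsto> f j]"
      using interval_le[of 1 2 i j] that assms abk k point_idempotent[OF n, of j] by auto
    from fun_cong[OF this, of "f j"] show ?thesis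
      by (auto simp: shift_map_def split: if_splits)
  qed
  from this[of i] this[of "Suc i"] injD[OF inj_f, of "Suc i" i]
  show "f (Suc i) = Suc (f i) \<or> f i = Suc (f (Suc i))" by fastforce
qed

text \<open>Products with one-point idempotents give \<open>k\<close> values of the image; a count
  of the domain excludes any others.\<close>

lemma shift_map_eq:
  assumes "n \<ge> 2" "k \<le> n"
  shows "\<sigma> (shift_map i j k) = shift_map (f 0 + i) (f 0 + j) k"
proof -
  let ?\<alpha> = "\<sigma> (shift_map i j k)" and ?\<epsilon> = "\<sigma> (shift_map i i k)"
  have n: "n \<ge> 1" using assms by simp
  have val: "?\<alpha> (f 0 + i + t) = Some (f 0 + j + t)" if "t < k" for t
  proof -
    have "shift_map i j k \<circ>\<^sub>m shift_map (i + t) (i + t) 1 = shift_map (i + t) (j + t) 1"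
      using that by (auto simp: shift_map_def fun_eq_iff map_comp_def)
    then have "?\<alpha> \<circ>\<^sub>m [f (i + t) \<mapsto> f (i + t)] = [f (i + t) \<mapsto> f (j + t)]"
      unfolding point[OF n, symmetric]
      using n assms(2) by (simp add: map_comp_shift_map del: One_nat_def)
    from fun_cong[OF this, of "f (i + t)"] show ?thesis
      by (simp add: f_eq[OF assms(1), of "i + t"] f_eq[OF assms(1), of "j + t"] add.assoc)
  qed
  have fin: "finite (dom ?\<epsilon>)"
    using closed[OF shift_map_in_carrier[OF assms(2)], of i i] by (simp add: conv_semigroup_def)
  \<comment> \<open>The upper bound: absorbing \<open>?\<epsilon>\<close> as first factor puts the
    domain of \<open>?\<alpha>\<close> inside that of \<open>?\<epsilon>\<close>, which has
    \<open>k\<close> points.\<close>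
  have "?\<alpha> \<circ>\<^sub>m ?\<epsilon> = ?\<alpha>"
  proof -
    have "shift_map i j k \<circ>\<^sub>m shift_map i i k = shift_map i j k"
      by (auto simp: shift_map_def fun_eq_iff map_comp_def)
    then show ?thesis
      using assms(2) by (simp add: map_comp_shift_map)
  qed
  then have sub: "dom ?\<alpha> \<subseteq> dom ?\<epsilon>"
    by (metis domIff map_comp_simps(1) subsetI)
  then have "card (dom ?\<alpha>) \<le> k"
    using card_mono[OF fin sub] card_dom_interval[OF assms(2), of i] by simp
  moreover have "{f 0 + i..<f 0 + i + k} \<subseteq> dom ?\<alpha>"
  proof
    fix x assume "x \<in> {f 0 + i..<f 0 + i + k}"
    then show "x \<in> dom ?\<alpha>" using val[of "x - (f 0 + i)"] by auto
  qed
  ultimately have dom: "dom ?\<alpha> = {f 0 + i..<f 0 + i + k}"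
    using card_seteq[of "dom ?\<alpha>" "{f 0 + i..<f 0 + i + k}"] finite_subset[OF sub fin] by simp
  show ?thesis
  proof
    fix x
    show "?\<alpha> x = shift_map (f 0 + i) (f 0 + j) k x"
    proof (cases "x \<in> {f 0 + i..<f 0 + i + k}")
      case True
      then show ?thesis using val[of "x - (f 0 + i)"] by (auto simp: shift_map_def)
    next
      case False
      then have "?\<alpha> x = None" using dom by (metis domIff)
      then show ?thesis using False by (simp add: shift_map_def)
    qed
  qed
qed

end

section \<open>Classification, isomorphism and automorphisms\<close>

lemma carrier_inj_End_conv_semigroup:
  assumes "n \<ge> 2"
  shows "carrier (inj_End (conv_semigroup n)) = range (shift_endo n)"
proof (intro equalityI subsetI)
  fix \<sigma> assume \<sigma>: "\<sigma> \<in> carrier (inj_End (conv_semigroup n))"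
  then interpret injective_endomorphism n \<sigma>
    by unfold_locales (simp add: inj_End_def)
  have "\<sigma> = shift_endo n (f 0)"
  proof (rule extensionalityI)
    show "\<sigma> \<in> extensional (carrier (conv_semigroup n))"
      using \<sigma> by (simp add: inj_End_def)
    show "shift_endo n (f 0) \<in> extensional (carrier (conv_semigroup n))"
      by (simp add: shift_endo_def)
    fix \<alpha> assume "\<alpha> \<in> carrier (conv_semigroup n)"
    then show "\<sigma> \<alpha> = shift_endo n (f 0) \<alpha>"
      unfolding carrier_conv_semigroup_shift_map
      using assms by (auto simp: shift_map_eq shift_endo_shift_map)
  qed
  then show "\<sigma> \<in> range (shift_endo n)" by blast
qed (auto intro: shift_endo_in_inj_End)

lemma inj_End_conv_semigroup_iso:
  assumes "n \<ge> 2"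
  shows "inj_End (conv_semigroup n) \<cong> omega_add"
proof -
  \<comment> \<open>The isomorphism must start at \<open>inj_End\<close>, so it is the inverse of
    the parametrization by \<open>p\<close>; \<open>shift_endo_mult\<close> makes it a
    homomorphism.\<close>
  let ?g = "inv_into UNIV (shift_endo n)"
  have inj: "inj (shift_endo n)"
    by (rule injI, rule shift_endo_inj[of n]) (use assms in auto)
  then have "bij_betw ?g (carrier (inj_End (conv_semigroup n))) UNIV"
    unfolding carrier_inj_End_conv_semigroup[OF assms]
    by (intro bij_betw_inv_into inj_on_imp_bij_betw)
  moreover have "?g \<in> hom (inj_End (conv_semigroup n)) omega_add"
    using inj by (auto simp: hom_def carrier_inj_End_conv_semigroup[OF assms] shift_endo_mult omega_add_def)
  ultimately show ?thesis
    by (auto simp: is_iso_def iso_def omega_add_def)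
qed

lemma auto_conv_semigroup:
  assumes "n \<ge> 2"
  shows "auto (conv_semigroup n) = {\<one>\<^bsub>BijGroup (carrier (conv_semigroup n))\<^esub>}"
proof -
  let ?S = "conv_semigroup n"
  have one: "\<one>\<^bsub>BijGroup (carrier ?S)\<^esub> = shift_endo n 0"
    by (auto simp: BijGroup_def shift_endo_def fun_eq_iff option.map_ident_strong)
  have "\<sigma> = shift_endo n 0" if "\<sigma> \<in> auto ?S" for \<sigma>
  proof -
    have \<sigma>: "\<sigma> \<in> hom ?S ?S" "bij_betw \<sigma> (carrier ?S) (carrier ?S)" "\<sigma> \<in> extensional (carrier ?S)"
      using that by (simp_all add: auto_def Bij_def)
    then have "\<sigma> \<in> carrier (inj_End ?S)"
      by (simp add: inj_End_def mon_def bij_betw_imp_inj_on)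
    then obtain p where p: "\<sigma> = shift_endo n p"
      unfolding carrier_inj_End_conv_semigroup[OF assms] by blast
    \<comment> \<open>Surjectivity is tested at the point 0: every map in the image of
      \<open>shift_endo n p\<close> has its domain in the numbers from \<open>p\<close> on, so
      reaching this element forces \<open>p = 0\<close>.\<close>
    have "shift_map 0 0 1 \<in> \<sigma> ` carrier ?S"
      using \<sigma>(2) assms by (simp add: bij_betw_def shift_map_in_carrier)
    then obtain \<alpha> where \<alpha>: "shift_map 0 0 1 = shift_endo n p \<alpha>" "\<alpha> \<in> carrier ?S"
      unfolding p by blast
    obtain i j k where "\<alpha> = shift_map i j k" "k \<le> n"
      using \<alpha>(2) unfolding carrier_conv_semigroup_shift_map by blast
    then have "shift_map 0 0 1 = shift_map (p + i) (p + j) k"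
      using \<alpha>(1) by (simp only: shift_endo_shift_map)
    from fun_cong[OF this, of 0] have "p = 0"
      by (simp add: shift_map_def split: if_splits)
    then show ?thesis using p by simp
  qed
  moreover have "shift_endo n 0 \<in> auto ?S"
  proof -
    have "shift_endo n 0 \<in> hom ?S ?S"
      using shift_endo_in_inj_End[of n 0] by (simp add: inj_End_def mon_def)
    then show ?thesis
      using id_Bij[of "carrier ?S"] one by (simp add: auto_def BijGroup_def)
  qed
  ultimately show ?thesis
    unfolding one by blast
qed

theorem theorem2:
  fixes n :: nat
  assumes "n \<ge> 2"
  shows "inj_End (conv_semigroup n) \<cong> omega_add \<and> trivial_group (AutoGroup (conv_semigroup n))"
proof
  show "inj_End (conv_semigroup n) \<cong> omega_add"
    using assms by (rule inj_End_conv_semigroup_iso)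
  let ?B = "BijGroup (carrier (conv_semigroup n))"
  \<comment> \<open>The semigroup is not a group, so the group laws of \<open>AutoGroup\<close> are
    taken from the trivial subgroup of \<open>?B\<close>, with which it coincides by
    \<open>auto_conv_semigroup\<close>.\<close>
  have "group (?B\<lparr>carrier := {\<one>\<^bsub>?B\<^esub>}\<rparr>)"
    using group.subgroup_imp_group[OF group_BijGroup group.triv_subgroup[OF group_BijGroup]] .
  then show "trivial_group (AutoGroup (conv_semigroup n))"
    by (simp add: trivial_group_def AutoGroup_def auto_conv_semigroup[OF assms])
qed

end
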